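(* Given a regex formula $\alpha$, one can construct in time $O(|\alpha|)$ a functional vset-automaton $A$ with $[\![A]\!]=[\![\alpha]\!]$.
   Context: Strings and spans. $\Sigma$ is a fixed finite alphabet with $|\Sigma|\ge 2$. A span of $\mathbf{s}=\sigma_1\cdots\sigma_\ell\in\Sigma^*$ is an expression $[i,j\rangle$ with $1\le i\le j\le \ell+1$. $\mathsf{Vars}$ is an infinite set of variables, disjoint from $\Sigma$. For finite $V\subset\mathsf{Vars}$, a $(V,\mathbf{s})$-tuple is a function from $V$ to the spans of $\mathbf{s}$; a spanner $P$ with finite variable set $\mathsf{Vars}(P)=V$ maps each $\mathbf{s}\in\Sigma^*$ to a set $P(\mathbf{s})$ of $(V,\mathbf{s})$-tuples. Ref-words. For finite $V\subset\mathsf{Vars}$ let $\Gamma_V=\{x{\vdash},\ {\dashv}x \mid x\in V\}$, disjoint from $\Sigma$. A word $\mathbf{r}\in(\Sigma\cup\Gamma_V)^*$ is valid for $V$ if for each $x\in V$ it contains exactly one $x{\vdash}$ and exactly one ${\dashv}x$, the former to the left of the latter. $\mathsf{clr}$ is the morphism erasing $\Gamma_V$ and fixing $\Sigma$. A valid $\mathbf{r}$ with $\mathsf{clr}(\mathbf{r})=\mathbf{s}$ defines the $(V,\mathbf{s})$-tuple $\mu^{\mathbf{r}}$: writing $\mathbf{r}=\mathbf{r}'_x\, x{\vdash}\,\mathbf{r}_x\,{\dashv}x\,\mathbf{r}''_x$, $\mu^{\mathbf{r}}(x)=[i,j\rangle$ with $i=|\mathsf{clr}(\mathbf{r}'_x)|+1$,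 $j=i+|\mathsf{clr}(\mathbf{r}_x)|$. Regex formulas. Syntax: $\alpha ::= \emptyset\mid\epsilon\mid\sigma\mid(\alpha\vee\alpha)\mid(\alpha\cdot\alpha)\mid\alpha^*\mid x\{\alpha\}$ with $\sigma\in\Sigma$, $x\in\mathsf{Vars}$. $\mathsf{Vars}(\alpha)$ is the set of variables occurring in $\alpha$; the size $|\alpha|$ is the number of symbols in $\alpha$. $\mathcal{R}(\alpha)$ is defined as the language of a regular expression, with $\mathcal{R}(x\{\beta\})=x{\vdash}\,\mathcal{R}(\beta)\,{\dashv}x$. The spanner $[\![\alpha]\!]$ has variables $\mathsf{Vars}(\alpha)$ and $[\![\alpha]\!](\mathbf{s})=\{\mu^{\mathbf{r}}\mid \mathbf{r}\in\mathcal{R}(\alpha)\text{ valid for }\mathsf{Vars}(\alpha),\ \mathsf{clr}(\mathbf{r})=\mathbf{s}\}$. Regex formulas are, by convention, assumed functional: every word in $\mathcal{R}(\alpha)$ is valid for $\mathsf{Vars}(\alpha)$. Vset-automata. A vset-automaton is a tuple $A=(V,Q,q_0,q_f,\delta)$ with $\mathsf{Vars}(A)=V\subset\mathsf{Vars}$ finite, $Q$ a finite set of states, $q_0,q_f\in Q$ initial and final states, and $\delta\colon Q\times(\Sigma\cup\{\epsilon\}\cup\Gamma_V)\to 2^Q$. $\mathcal{R}(A)$ is the set of words over $\Sigma\cup\Gamma_V$ accepted by $A$ viewed as an $\epsilon$-NFA. $[\![A]\!](\mathbf{s})=\{\mu^{\mathbf{r}}\mid\mathbf{r}\in\mathcal{R}(A)\text{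 valid for }V,\ \mathsf{clr}(\mathbf{r})=\mathbf{s}\}$. $A$ is functional if every word in $\mathcal{R}(A)$ is valid for $V$. Running times are in the unit-cost RAM model with machine words of size logarithmic in the input size. *)

theory Defs
  imports "HOL-Library.Cardinality"
begin

section \<open>Ref-words, tuples, spanners\<close>

text \<open>The alphabet is the type \<open>'a\<close>, the set of variables is the type \<open>'v\<close>; a ref-word is a
  list over their tagged, hence disjoint, union.\<close>

datatype ('a, 'v) rsym = Letter 'a | Open 'v | Close 'v

definition Gamma :: "'v set \<Rightarrow> ('a, 'v) rsym set" where
  "Gamma V = Open ` V \<union> Close ` V"

fun clr :: "('a, 'v) rsym list \<Rightarrow> 'a list" where
  "clr [] = []"
| "clr (Letter a # r) = a # clr r"
| "clr (Open x # r) = clr r"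
| "clr (Close x # r) = clr r"

definition valid :: "'v set \<Rightarrow> ('a, 'v) rsym list \<Rightarrow> bool" where
  "valid V r \<longleftrightarrow> set r \<subseteq> range Letter \<union> Gamma V \<and>
     (\<forall>x\<in>V. count_list r (Open x) = 1 \<and> count_list r (Close x) = 1 \<and>
        (\<exists>r1 r2 r3. r = r1 @ [Open x] @ r2 @ [Close x] @ r3))"

text \<open>The pair \<open>(i, j)\<close> stands for the span \<open>[i,j\<rangle>\<close>, and a tuple over \<open>V\<close> is a partial map with
  domain \<open>V\<close>. On valid ref-words the decomposition below, and hence the span, is unique.\<close>

type_synonym span = "nat \<times> nat"

definition mu :: "'v set \<Rightarrow> ('a, 'v) rsym list \<Rightarrow> 'v \<rightharpoonup> span" where
  "mu V r = (\<lambda>x. if x \<in> V then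
     Some (THE p. \<exists>r1 r2 r3. r = r1 @ [Open x] @ r2 @ [Close x] @ r3 \<and>
             p = (length (clr r1) + 1, length (clr r1) + 1 + length (clr r2)))
     else None)"

text \<open>A spanner is given by its variables together with its map from strings to sets of tuples.\<close>

type_synonym ('a, 'v) spanner = "'v set \<times> ('a list \<Rightarrow> ('v \<rightharpoonup> span) set)"

definition spanner_of :: "'v set \<Rightarrow> ('a, 'v) rsym list set \<Rightarrow> ('a, 'v) spanner" where
  "spanner_of V L = (V, \<lambda>s. {mu V r | r. r \<in> L \<and> valid V r \<and> clr r = s})"


section \<open>Regex formulas\<close>

datatype ('a, 'v) regex =
    Empty
  | Epsilon
  | Sym 'a
  | Or "('a, 'v) regex" "('a, 'v) regex"
  | Cat "('a, 'v) regex" "('a, 'v) regex"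
  | Star "('a, 'v) regex"
  | Bind 'v "('a, 'v) regex"

fun vars :: "('a, 'v) regex \<Rightarrow> 'v set" where
  "vars Empty = {}"
| "vars Epsilon = {}"
| "vars (Sym a) = {}"
| "vars (Or \<alpha> \<beta>) = vars \<alpha> \<union> vars \<beta>"
| "vars (Cat \<alpha> \<beta>) = vars \<alpha> \<union> vars \<beta>"
| "vars (Star \<alpha>) = vars \<alpha>"
| "vars (Bind x \<alpha>) = insert x (vars \<alpha>)"

fun ref_words :: "('a, 'v) regex \<Rightarrow> ('a, 'v) rsym list set" where
  "ref_words Empty = {}"
| "ref_words Epsilon = {[]}"
| "ref_words (Sym a) = {[Letter a]}"
| "ref_words (Or \<alpha> \<beta>) = ref_words \<alpha> \<union> ref_words \<beta>"
| "ref_words (Cat \<alpha> \<beta>) = {u @ v | u v. u \<in> ref_words \<alpha> \<and> v \<in> ref_words \<beta>}"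
| "ref_words (Star \<alpha>) = {concat us | us. set us \<subseteq> ref_words \<alpha>}"
| "ref_words (Bind x \<alpha>) = {[Open x] @ u @ [Close x] | u. u \<in> ref_words \<alpha>}"

definition functional_regex :: "('a, 'v) regex \<Rightarrow> bool" where
  "functional_regex \<alpha> \<longleftrightarrow> (\<forall>r \<in> ref_words \<alpha>. valid (vars \<alpha>) r)"

definition regex_spanner :: "('a, 'v) regex \<Rightarrow> ('a, 'v) spanner" where
  "regex_spanner \<alpha> = spanner_of (vars \<alpha>) (ref_words \<alpha>)"

text \<open>A regex formula is a word, fully parenthesised as in the grammar
  \<open>\<alpha> ::= \<emptyset> | \<epsilon> | \<sigma> | (\<alpha> \<or> \<alpha>) | (\<alpha> \<cdot> \<alpha>) | \<alpha>* | x{\<alpha>}\<close>; its size is the length of that word.\<close>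

datatype ('a, 'v) token =
    TEmpty | TEpsilon | TLParen | TRParen | TOr | TCat | TStar | TLBrace | TRBrace
  | TSym 'a | TVar 'v

fun tokens :: "('a, 'v) regex \<Rightarrow> ('a, 'v) token list" where
  "tokens Empty = [TEmpty]"
| "tokens Epsilon = [TEpsilon]"
| "tokens (Sym a) = [TSym a]"
| "tokens (Or \<alpha> \<beta>) = [TLParen] @ tokens \<alpha> @ [TOr] @ tokens \<beta> @ [TRParen]"
| "tokens (Cat \<alpha> \<beta>) = [TLParen] @ tokens \<alpha> @ [TCat] @ tokens \<beta> @ [TRParen]"
| "tokens (Star \<alpha>) = tokens \<alpha> @ [TStar]"
| "tokens (Bind x \<alpha>) = [TVar x, TLBrace] @ tokens \<alpha> @ [TRBrace]"

definition regex_size :: "('a, 'v) regex \<Rightarrow> nat" where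
  "regex_size \<alpha> = length (tokens \<alpha>)"


section \<open>Vset-automata\<close>

text \<open>The label \<open>None\<close> is \<open>\<epsilon>\<close>. Since \<open>delta\<close> is total in HOL, \<open>vset_automaton\<close> requires it to be
  empty outside \<open>Q \<times> (\<Sigma> \<union> {\<epsilon>} \<union> \<Gamma>\<^sub>V)\<close>.\<close>

record ('q, 'a, 'v) vsa =
  avars :: "'v set"
  states :: "'q set"
  init :: 'q
  final :: 'q
  delta :: "'q \<Rightarrow> ('a, 'v) rsym option \<Rightarrow> 'q set"

definition vset_automaton :: "('q, 'a, 'v) vsa \<Rightarrow> bool" where
  "vset_automaton A \<longleftrightarrow> finite (avars A) \<and> finite (states A) \<and>
     init A \<in> states A \<and> final A \<in> states A \<and>
     (\<forall>q l. delta A q l \<subseteq> states A) \<and>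
     (\<forall>q l. delta A q l \<noteq> {} \<longrightarrow>
        q \<in> states A \<and> l \<in> {None} \<union> Some ` (range Letter \<union> Gamma (avars A)))"

inductive run :: "('q, 'a, 'v) vsa \<Rightarrow> 'q \<Rightarrow> ('a, 'v) rsym list \<Rightarrow> 'q \<Rightarrow> bool"
  for A :: "('q, 'a, 'v) vsa" where
  run_refl: "run A p [] p"
| run_eps: "q \<in> delta A p None \<Longrightarrow> run A q r p' \<Longrightarrow> run A p r p'"
| run_sym: "q \<in> delta A p (Some l) \<Longrightarrow> run A q r p' \<Longrightarrow> run A p (l # r) p'"

definition accepted :: "('q, 'a, 'v) vsa \<Rightarrow> ('a, 'v) rsym list set" where
  "accepted A = {r. run A (init A) r (final A)}"

definition functional_vsa :: "('q, 'a, 'v) vsa \<Rightarrow> bool" where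
  "functional_vsa A \<longleftrightarrow> (\<forall>r \<in> accepted A. valid (avars A) r)"

definition vsa_spanner :: "('q, 'a, 'v) vsa \<Rightarrow> ('a, 'v) spanner" where
  "vsa_spanner A = spanner_of (avars A) (accepted A)"


section \<open>Unit-cost RAM with \<open>w\<close>-bit words\<close>

text \<open>Every instruction costs one step. Registers and memory cells hold words, i.e. numbers below
  \<open>2 ^ w\<close>, and memory is addressed by words; a program refers to finitely many registers only.
  Subtraction is truncated at \<open>0\<close>, the other results are taken modulo \<open>2 ^ w\<close>. The machine halts
  when the program counter leaves the program.\<close>

datatype instr =
    Const nat nat             \<comment> \<open>\<open>R[d] := k\<close>\<close>
  | Add nat nat nat           \<comment> \<open>\<open>R[d] := R[a] + R[b]\<close>\<close>
  | Sub nat nat nat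
  | Mul nat nat nat
  | Div nat nat nat
  | Load nat nat              \<comment> \<open>\<open>R[d] := M[R[a]]\<close>\<close>
  | Store nat nat             \<comment> \<open>\<open>M[R[a]] := R[b]\<close>\<close>
  | Jump nat
  | JumpLess nat nat nat      \<comment> \<open>if \<open>R[a] < R[b]\<close> jump to the last argument\<close>

datatype config = Config (pc: nat) (regs: "nat \<Rightarrow> nat") (mem: "nat \<Rightarrow> nat")

fun exec :: "nat \<Rightarrow> instr \<Rightarrow> config \<Rightarrow> config" where
  "exec w (Const d k) (Config i R M) = Config (i + 1) (R(d := k mod 2 ^ w)) M"
| "exec w (Add d a b) (Config i R M) = Config (i + 1) (R(d := (R a + R b) mod 2 ^ w)) M"
| "exec w (Sub d a b) (Config i R M) = Config (i + 1) (R(d := R a - R b)) M"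
| "exec w (Mul d a b) (Config i R M) = Config (i + 1) (R(d := (R a * R b) mod 2 ^ w)) M"
| "exec w (Div d a b) (Config i R M) = Config (i + 1) (R(d := R a div R b)) M"
| "exec w (Load d a) (Config i R M) = Config (i + 1) (R(d := M (R a))) M"
| "exec w (Store a b) (Config i R M) = Config (i + 1) R (M(R a := R b))"
| "exec w (Jump j) (Config i R M) = Config j R M"
| "exec w (JumpLess a b j) (Config i R M) = Config (if R a < R b then j else i + 1) R M"

definition halted :: "instr list \<Rightarrow> config \<Rightarrow> bool" where
  "halted P c \<longleftrightarrow> length P \<le> pc c"

definition step :: "nat \<Rightarrow> instr list \<Rightarrow> config \<Rightarrow> config" where
  "step w P c = (if halted P c then c else exec w (P ! pc c) c)"

text \<open>The input occupies the memory from address \<open>0\<close> on, with its length in register \<open>0\<close>; all else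
  is \<open>0\<close>. On halting, registers \<open>0\<close> and \<open>1\<close> hold the start address and the length of the output.\<close>

definition initial :: "nat list \<Rightarrow> config" where
  "initial xs = Config 0 ((\<lambda>_. 0)(0 := length xs)) (\<lambda>i. if i < length xs then xs ! i else 0)"

definition ram_output :: "config \<Rightarrow> nat list" where
  "ram_output c = map (mem c) [regs c 0 ..< regs c 0 + regs c 1]"

definition computes_within :: "nat \<Rightarrow> instr list \<Rightarrow> nat list \<Rightarrow> nat \<Rightarrow> nat list \<Rightarrow> bool" where
  "computes_within w P xs T ys \<longleftrightarrow>
     (\<exists>t\<le>T. halted P ((step w P ^^ t) (initial xs)) \<and> ram_output ((step w P ^^ t) (initial xs)) = ys)"


section \<open>Representation of formulas and automata by words\<close>

text \<open>Letters and variables are numbered by \<open>sc\<close> and \<open>vc\<close>, where \<open>sc\<close> takes values below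
  \<open>CARD('a)\<close>. Each symbol of a formula takes exactly one word, so that the length of the input is
  the size of the formula.\<close>

fun token_code :: "('a \<Rightarrow> nat) \<Rightarrow> ('v \<Rightarrow> nat) \<Rightarrow> ('a, 'v) token \<Rightarrow> nat" where
  "token_code sc vc TEmpty = 0"
| "token_code sc vc TEpsilon = 1"
| "token_code sc vc TLParen = 2"
| "token_code sc vc TRParen = 3"
| "token_code sc vc TOr = 4"
| "token_code sc vc TCat = 5"
| "token_code sc vc TStar = 6"
| "token_code sc vc TLBrace = 7"
| "token_code sc vc TRBrace = 8"
| "token_code sc vc (TSym a) = 9 + sc a"
| "token_code sc vc (TVar x) = 9 + CARD('a) + vc x"

definition regex_code :: "('a \<Rightarrow> nat) \<Rightarrow> ('v \<Rightarrow> nat) \<Rightarrow> ('a, 'v) regex \<Rightarrow> nat list" where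
  "regex_code sc vc \<alpha> = map (token_code sc vc) (tokens \<alpha>)"

fun label_code :: "('a \<Rightarrow> nat) \<Rightarrow> ('v \<Rightarrow> nat) \<Rightarrow> ('a, 'v) rsym option \<Rightarrow> nat list" where
  "label_code sc vc None = [0, 0]"
| "label_code sc vc (Some (Letter a)) = [1, sc a]"
| "label_code sc vc (Some (Open x)) = [2, vc x]"
| "label_code sc vc (Some (Close x)) = [3, vc x]"

text \<open>An automaton with states \<open>0, \<dots>, m - 1\<close> is written out as \<open>m\<close>, its initial and its final state,
  and a list of its variables and one of its transitions, each preceded by its length. These lists
  enumerate sets, so their order and repetitions in them are irrelevant.\<close>

definition vsa_code ::
  "('a \<Rightarrow> nat) \<Rightarrow> ('v \<Rightarrow> nat) \<Rightarrow> (nat, 'a, 'v) vsa \<Rightarrow> nat list \<Rightarrow> bool" where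
  "vsa_code sc vc A ys \<longleftrightarrow>
     (\<exists>m vs ts. states A = {..<m} \<and> set vs = avars A \<and>
        set ts = {(p, l, q). q \<in> delta A p l} \<and>
        ys = [m, init A, final A] @ [length vs] @ map vc vs @
             [length ts] @ concat (map (\<lambda>(p, l, q). [p] @ label_code sc vc l @ [q]) ts))"

end

theory Submission
  imports Defs
begin

text \<open>
  For a formula of size \<open>n\<close>, take as states the \<open>n + 1\<close> boundaries \<open>0, \<dots>, n\<close> between the symbols of
  the formula, and one more state \<open>n + 1\<close> without incoming edges. A subformula that occupies the
  symbols \<open>i, \<dots>, j - 1\<close> becomes the part of the automaton that leads from state \<open>i\<close> to state \<open>j\<close>. Each
  symbol contributes at most two edges, and these depend only on the position, the symbol, and the
  positions where the enclosing or just completed subformulas begin and have their operator. A stack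
  provides the latter, so one left-to-right pass suffices. The automaton accepts exactly
  the ref-words of the formula, whence it is functional and has the same spanner.
\<close>

section \<open>The automaton\<close>

type_synonym ('a, 'v) edge = "nat \<times> ('a, 'v) rsym option \<times> nat"

abbreviation eps :: "nat \<Rightarrow> nat \<Rightarrow> ('a, 'v) edge" where
  "eps p q \<equiv> (p, None, q)"

text \<open>\<open>i\<close> is the position of the formula and \<open>D\<close> a state without incoming edges. An edge from \<open>D\<close> has
  no effect; it pads the contribution of every symbol to exactly two edges.\<close>

fun edges :: "nat \<Rightarrow> nat \<Rightarrow> ('a, 'v) regex \<Rightarrow> ('a, 'v) edge list" where
  "edges D i Empty = [eps D (i + 1), eps D (i + 1)]"
| "edges D i Epsilon = [eps i (i + 1), eps D (i + 1)]"
| "edges D i (Sym a) = [(i, Some (Letter a), i + 1), eps D (i + 1)]"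
| "edges D i (Or \<alpha> \<beta>) = (let k = i + 1 + regex_size \<alpha>; l = k + 1 + regex_size \<beta> in
     [eps i (i + 1), eps D (i + 1)] @ edges D (i + 1) \<alpha> @
     [eps D (k + 1), eps i (k + 1)] @ edges D (k + 1) \<beta> @
     [eps l (l + 1), eps k (l + 1)])"
| "edges D i (Cat \<alpha> \<beta>) = (let k = i + 1 + regex_size \<alpha>; l = k + 1 + regex_size \<beta> in
     [eps i (i + 1), eps D (i + 1)] @ edges D (i + 1) \<alpha> @
     [eps k (k + 1), eps D (k + 1)] @ edges D (k + 1) \<beta> @
     [eps l (l + 1), eps D (l + 1)])"
| "edges D i (Star \<alpha>) = (let k = i + regex_size \<alpha> in
     edges D i \<alpha> @ [eps k i, eps i (k + 1)])"
| "edges D i (Bind x \<alpha>) = (let k = i + 2 + regex_size \<alpha> in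
     [(i, Some (Open x), i + 1), eps D (i + 1), eps (i + 1) (i + 2), eps D (i + 2)] @
     edges D (i + 2) \<alpha> @ [(k, Some (Close x), k + 1), eps D (k + 1)])"

lemma regex_size_simps [simp]:
  "regex_size Empty = 1"
  "regex_size Epsilon = 1"
  "regex_size (Sym a) = 1"
  "regex_size (Or \<alpha> \<beta>) = 3 + regex_size \<alpha> + regex_size \<beta>"
  "regex_size (Cat \<alpha> \<beta>) = 3 + regex_size \<alpha> + regex_size \<beta>"
  "regex_size (Star \<alpha>) = 1 + regex_size \<alpha>"
  "regex_size (Bind x \<alpha>) = 3 + regex_size \<alpha>"
  by (simp_all add: regex_size_def)

lemma regex_size_pos: "0 < regex_size \<alpha>"
  by (induction \<alpha>) simp_all

lemma edges_bounds:
  assumes "(p, l, q) \<in> set (edges D i \<alpha>)"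
  shows "p = D \<or> i \<le> p \<and> p \<le> i + regex_size \<alpha>" "i \<le> q" "q \<le> i + regex_size \<alpha>"
  using assms by (induction \<alpha> arbitrary: i) (fastforce simp: Let_def)+

lemma edges_label:
  "(p, Some a, q) \<in> set (edges D i \<alpha>) \<Longrightarrow> a \<in> range Letter \<union> Gamma (vars \<alpha>)"
  by (induction \<alpha> arbitrary: i) (auto simp: Let_def Gamma_def image_Un)

text \<open>This uniform count allows the number of transitions to be written before any symbol has
  been read.\<close>

lemma length_edges: "length (edges D i \<alpha>) = 2 * regex_size \<alpha>"
  by (induction \<alpha> arbitrary: i) (simp_all add: Let_def)

lemma finite_vars: "finite (vars \<alpha>)"
  by (induction \<alpha>) simp_all

section \<open>Completeness: ref-words label runs\<close>

lemma run_append: "run A p u q \<Longrightarrow> run A q v r \<Longrightarrow> run A p (u @ v) r"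
  by (induction rule: run.induct) (auto intro: run.intros)

lemma run_eps_single: "q \<in> delta A p None \<Longrightarrow> run A p [] q"
  by (blast intro: run.intros)

lemma run_sym_single: "q \<in> delta A p (Some a) \<Longrightarrow> run A p [a] q"
  by (blast intro: run.intros)

text \<open>The edges only have to be contained in \<open>delta A\<close>, so the hypothesis passes
  to subformulas while \<open>A\<close> stays fixed.\<close>

lemma edges_complete:
  assumes "\<And>p l q. (p, l, q) \<in> set (edges D i \<alpha>) \<Longrightarrow> q \<in> delta A p l"
    and "u \<in> ref_words \<alpha>"
  shows "run A i u (i + regex_size \<alpha>)"
  using assms
proof (induction \<alpha> arbitrary: i u)
  case Empty
  then show ?case by simp
next
  case Epsilon
  then show ?case by (simp add: run_eps_single)
next
  case (Sym a)
  then show ?case by (simp add: run_sym_single)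
next
  case (Or \<alpha> \<beta>)
  let ?k = "i + 1 + regex_size \<alpha>"
  let ?l = "?k + 1 + regex_size \<beta>"
  have e: "run A i [] (i + 1)" "run A i [] (?k + 1)" "run A ?k [] (?l + 1)" "run A ?l [] (?l + 1)"
    by (rule run_eps_single, rule Or.prems, simp add: Let_def)+
  have sub: "u \<in> ref_words \<alpha> \<Longrightarrow> run A (i + 1) u ?k" "u \<in> ref_words \<beta> \<Longrightarrow> run A (?k + 1) u ?l"
    by (rule Or.IH, rule Or.prems; simp add: Let_def)+
  have "run A i u (?l + 1)"
    using Or.prems(2) run_append[OF run_append[OF e(1) sub(1)] e(3)]
      run_append[OF run_append[OF e(2) sub(2)] e(4)] by auto
  then show ?case by (simp add: numeral_3_eq_3 add_ac)
next
  case (Cat \<alpha> \<beta>)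
  let ?k = "i + 1 + regex_size \<alpha>"
  let ?l = "?k + 1 + regex_size \<beta>"
  obtain v v' where u: "u = v @ v'" "v \<in> ref_words \<alpha>" "v' \<in> ref_words \<beta>"
    using Cat.prems(2) by auto
  have e: "run A i [] (i + 1)" "run A ?k [] (?k + 1)" "run A ?l [] (?l + 1)"
    by (rule run_eps_single, rule Cat.prems, simp add: Let_def)+
  have sub: "run A (i + 1) v ?k" "run A (?k + 1) v' ?l"
    by (rule Cat.IH, rule Cat.prems; simp add: Let_def u)+
  have "run A i u (?l + 1)"
    using run_append[OF run_append[OF run_append[OF run_append[OF e(1) sub(1)] e(2)] sub(2)] e(3)] u
    by simp
  then show ?case by (simp add: numeral_3_eq_3 add_ac)
next
  case (Star \<alpha>)
  let ?k = "i + regex_size \<alpha>"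
  obtain us where u: "u = concat us" "set us \<subseteq> ref_words \<alpha>"
    using Star.prems(2) by auto
  have e: "run A ?k [] i" "run A i [] (?k + 1)"
    by (rule run_eps_single, rule Star.prems, simp add: Let_def)+
  have sub: "run A i v ?k" if "v \<in> ref_words \<alpha>" for v
    by (rule Star.IH, rule Star.prems; simp add: Let_def that)
  have "run A i (concat us) i"
    using u(2)
  proof (induction us)
    case (Cons v us)
    then show ?case using run_append[OF run_append[OF sub e(1)]] by simp
  qed (simp add: run_refl)
  then show ?case using run_append[OF _ e(2)] u by simp
next
  case (Bind x \<alpha>)
  let ?k = "i + 2 + regex_size \<alpha>"
  obtain v where u: "u = [Open x] @ v @ [Close x]" "v \<in> ref_words \<alpha>"
    using Bind.prems(2) by auto
  have e: "run A (i + 1) [] (i + 2)"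
    by (rule run_eps_single, rule Bind.prems, simp add: Let_def)
  have s: "run A i [Open x] (i + 1)" "run A ?k [Close x] (?k + 1)"
    by (rule run_sym_single, rule Bind.prems, simp add: Let_def)+
  have sub: "run A (i + 2) v ?k"
    by (rule Bind.IH, rule Bind.prems; simp add: Let_def u)
  have "run A i u (?k + 1)"
    using run_append[OF run_append[OF run_append[OF s(1) e] sub] s(2)] u by simp
  then show ?case by (simp add: numeral_3_eq_3 add_ac)
qed

section \<open>Soundness by residual languages\<close>

definition conc :: "'b list set \<Rightarrow> 'b list set \<Rightarrow> 'b list set" where
  "conc X Y = {u @ v | u v. u \<in> X \<and> v \<in> Y}"

lemma conc_assoc: "conc (conc X Y) Z = conc X (conc Y Z)"
  unfolding conc_def by (auto; metis append.assoc)

lemma conc_mono: "X \<subseteq> X' \<Longrightarrow> Y \<subseteq> Y' \<Longrightarrow> conc X Y \<subseteq> conc X' Y'"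
  unfolding conc_def by blast

definition label_words :: "('a, 'v) rsym option \<Rightarrow> ('a, 'v) rsym list set" where
  "label_words l = {case l of None \<Rightarrow> [] | Some a \<Rightarrow> [a]}"

text \<open>If \<open>L\<close> is closed under the edges, then \<open>L p\<close> contains every word that leads from \<open>p\<close> to a state
  \<open>r\<close> with \<open>[] \<in> L r\<close>. Soundness amounts to finding such an \<open>L\<close> which is small at the initial state.\<close>

definition closed_under :: "('a, 'v) edge set \<Rightarrow> (nat \<Rightarrow> ('a, 'v) rsym list set) \<Rightarrow> bool" where
  "closed_under E L \<longleftrightarrow> (\<forall>(p, l, q) \<in> E. conc (label_words l) (L q) \<subseteq> L p)"

lemma run_residual:
  assumes "closed_under E L" and "\<And>p l q. q \<in> delta A p l \<Longrightarrow> (p, l, q) \<in> E"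
    and "run A p u r" and "[] \<in> L r"
  shows "u \<in> L p"
  using assms(3,4)
proof induction
  case (run_eps q p u r)
  then have "(p, None, q) \<in> E" using assms(2) by blast
  then have "conc (label_words None) (L q) \<subseteq> L p" using assms(1) by (auto simp: closed_under_def)
  then show ?case using run_eps by (auto simp: conc_def label_words_def)
next
  case (run_sym q p l u r)
  then have "(p, Some l, q) \<in> E" using assms(2) by blast
  then have "conc (label_words (Some l)) (L q) \<subseteq> L p" using assms(1) by (auto simp: closed_under_def)
  then show ?case using run_sym by (auto simp: conc_def label_words_def)
qed simp

text \<open>A starred formula shares its initial state with its body, so it is the only kind of formula
  with edges back into its initial state.\<close>

fun entry_loops :: "('a, 'v) regex \<Rightarrow> ('a, 'v) rsym list set" where
  "entry_loops (Star \<alpha>) = ref_words \<alpha>"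
| "entry_loops _ = {}"

lemma entry_loops_subset: "entry_loops \<alpha> \<subseteq> ref_words \<alpha>"
proof (cases \<alpha>)
  case (Star \<beta>)
  have "\<exists>us. u = concat us \<and> set us \<subseteq> ref_words \<beta>" if "u \<in> ref_words \<beta>" for u
    using that by (intro exI[of _ "[u]"]) simp
  then show ?thesis using Star by auto
qed auto

lemma entry_loops_conc: "conc (entry_loops \<alpha>) (ref_words \<alpha>) \<subseteq> ref_words \<alpha>"
proof (cases \<alpha>)
  case (Star \<beta>)
  have "\<exists>vs. u @ concat us = concat vs \<and> set vs \<subseteq> ref_words \<beta>"
    if "u \<in> ref_words \<beta>" "set us \<subseteq> ref_words \<beta>" for u us
    using that by (intro exI[of _ "u # us"]) simp
  then show ?thesis using Star by (auto simp: conc_def)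
qed (auto simp: conc_def)


lemma closed_under_Un: "closed_under (E \<union> F) L \<longleftrightarrow> closed_under E L \<and> closed_under F L"
  unfolding closed_under_def by blast

lemma closed_under_insert:
  "closed_under (insert (p, l, q) F) L \<longleftrightarrow> conc (label_words l) (L q) \<subseteq> L p \<and> closed_under F L"
  unfolding closed_under_def by blast

lemma closed_under_empty: "closed_under {} L"
  unfolding closed_under_def by blast

lemma conc_label_None [simp]: "conc (label_words None) X = X"
  by (simp add: conc_def label_words_def)

lemmas closed_under_simps = closed_under_Un closed_under_insert closed_under_empty

text \<open>\<open>L p\<close> stands for the words still readable from \<open>p\<close> if
  \<open>K\<close> is what follows the formula. Taking \<open>UNIV\<close> at \<open>D\<close> makes
  the padding edges harmless.\<close>

definition residual ::
  "nat \<Rightarrow> nat \<Rightarrow> ('a, 'v) regex \<Rightarrow> ('a, 'v) rsym list set \<Rightarrow> ('a, 'v) rsym list set \<Rightarrow>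
     (nat \<Rightarrow> ('a, 'v) rsym list set) \<Rightarrow> bool" where
  "residual D i \<alpha> X K L \<longleftrightarrow> closed_under (set (edges D i \<alpha>)) L \<and> L D = UNIV \<and>
     L i = X \<and> L (i + regex_size \<alpha>) = K"

text \<open>Closedness involves \<open>L\<close> only at \<open>D\<close> and on the interval of the
  formula, so the languages found for subformulas can be pasted together.\<close>

lemma residual_cong:
  assumes "residual D i \<alpha> X K L" and "L' D = UNIV"
    and "\<And>p. i \<le> p \<Longrightarrow> p \<le> i + regex_size \<alpha> \<Longrightarrow> L' p = L p"
  shows "residual D i \<alpha> X K L'"
proof -
  have "L' p = L p \<and> L' q = L q" if "(p, l, q) \<in> set (edges D i \<alpha>)" for p l q
    using edges_bounds[OF that] assms by (auto simp: residual_def)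
  then have "closed_under (set (edges D i \<alpha>)) L'"
    using assms(1) unfolding residual_def closed_under_def by fastforce
  then show ?thesis
    using assms by (simp add: residual_def)
qed

text \<open>\<open>K\<close> is the language of the continuation. The language \<open>X\<close> at the initial state may be larger than
  what the formula and \<open>K\<close> require: the body of a star is used with \<open>K = X\<close>.\<close>

lemma residual_ex:
  assumes "i + regex_size \<alpha> < D"
    and "conc (ref_words \<alpha>) K \<subseteq> X" and "conc (entry_loops \<alpha>) X \<subseteq> X"
  shows "\<exists>L. residual D i \<alpha> X K L"
  using assms
proof (induction \<alpha> arbitrary: i X K)
  case Empty
  then show ?case
    by (intro exI[of _ "(\<lambda>_. UNIV)(i := X, i + 1 := K)"]) (simp add: residual_def closed_under_simps)
next
  case Epsilon
  then show ?case
    by (intro exI[of _ "(\<lambda>_. UNIV)(i := X, i + 1 := K)"])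
       (simp add: residual_def closed_under_simps, simp add: conc_def)
next
  case (Sym a)
  then show ?case
    by (intro exI[of _ "(\<lambda>_. UNIV)(i := X, i + 1 := K)"])
       (simp add: residual_def closed_under_simps, simp add: conc_def label_words_def)
next
  case (Or \<alpha> \<beta>)
  let ?k = "i + 1 + regex_size \<alpha>"
  let ?l = "?k + 1 + regex_size \<beta>"
  \<comment> \<open>The choice \<open>X = conc (ref_words \<gamma>) K\<close> meets the entry-loop
    hypothesis for every operand, starred or not.\<close>
  have sub: "conc (entry_loops \<gamma>) (conc (ref_words \<gamma>) K) \<subseteq> conc (ref_words \<gamma>) K" for \<gamma>
    using entry_loops_conc[of \<gamma>] by (simp add: conc_assoc[symmetric] conc_mono)
  obtain L1 where L1: "residual D (i + 1) \<alpha> (conc (ref_words \<alpha>) K) K L1"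
    using Or.IH(1)[of "i + 1" K "conc (ref_words \<alpha>) K"] Or.prems(1) sub by auto
  obtain L2 where L2: "residual D (?k + 1) \<beta> (conc (ref_words \<beta>) K) K L2"
    using Or.IH(2)[of "?k + 1" K "conc (ref_words \<beta>) K"] Or.prems(1) sub by auto
  \<comment> \<open>The operands occupy disjoint intervals of states, with \<open>D\<close> beyond
    all of them.\<close>
  define L where "L p = (if p = D then UNIV else if p = i then X else if p \<le> ?k then L1 p
    else if p \<le> ?l then L2 p else K)" for p
  have "residual D (i + 1) \<alpha> (conc (ref_words \<alpha>) K) K L"
    by (rule residual_cong[OF L1]) (use Or.prems(1) in \<open>auto simp: L_def\<close>)
  moreover have "residual D (?k + 1) \<beta> (conc (ref_words \<beta>) K) K L"
    by (rule residual_cong[OF L2]) (use Or.prems(1) in \<open>auto simp: L_def\<close>)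
  moreover have "L D = UNIV" "L i = X" "L (?l + 1) = K"
    using Or.prems(1) L1 by (auto simp: L_def residual_def)
  moreover have "conc (ref_words \<alpha>) K \<subseteq> X" "conc (ref_words \<beta>) K \<subseteq> X"
    using Or.prems(2) by (auto simp: conc_def)
  ultimately have "residual D i (Or \<alpha> \<beta>) X K L"
    by (simp add: residual_def closed_under_simps Let_def numeral_3_eq_3 add_ac)
  then show ?case by (rule exI[of _ L])
next
  case (Cat \<alpha> \<beta>)
  let ?k = "i + 1 + regex_size \<alpha>"
  let ?l = "?k + 1 + regex_size \<beta>"
  have sub: "conc (entry_loops \<gamma>) (conc (ref_words \<gamma>) K) \<subseteq> conc (ref_words \<gamma>) K" for \<gamma> K
    using entry_loops_conc[of \<gamma>] by (simp add: conc_assoc[symmetric] conc_mono)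
  define K1 where "K1 = conc (ref_words \<beta>) K"
  obtain L1 where L1: "residual D (i + 1) \<alpha> (conc (ref_words \<alpha>) K1) K1 L1"
    using Cat.IH(1)[of "i + 1" K1 "conc (ref_words \<alpha>) K1"] Cat.prems(1) sub by auto
  obtain L2 where L2: "residual D (?k + 1) \<beta> K1 K L2"
    using Cat.IH(2)[of "?k + 1" K K1] Cat.prems(1) sub by (auto simp: K1_def)
  define L where "L p = (if p = D then UNIV else if p = i then X else if p \<le> ?k then L1 p
    else if p \<le> ?l then L2 p else K)" for p
  have "residual D (i + 1) \<alpha> (conc (ref_words \<alpha>) K1) K1 L"
    by (rule residual_cong[OF L1]) (use Cat.prems(1) in \<open>auto simp: L_def\<close>)
  moreover have "residual D (?k + 1) \<beta> K1 K L"
    by (rule residual_cong[OF L2]) (use Cat.prems(1) in \<open>auto simp: L_def\<close>)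
  moreover have "L D = UNIV" "L i = X" "L (?l + 1) = K"
    using Cat.prems(1) L1 by (auto simp: L_def residual_def)
  moreover have "conc (ref_words \<alpha>) K1 \<subseteq> X"
    using Cat.prems(2) by (simp add: K1_def conc_assoc[symmetric]) (simp add: conc_def)
  ultimately have "residual D i (Cat \<alpha> \<beta>) X K L"
    by (simp add: residual_def closed_under_simps Let_def numeral_3_eq_3 add_ac)
  then show ?case by (rule exI[of _ L])
next
  case (Star \<alpha>)
  let ?k = "i + regex_size \<alpha>"
  \<comment> \<open>The back edge from \<open>?k\<close> to \<open>i\<close> is respected if both
    ends of the body carry \<open>X\<close>; the entry-loop hypothesis permits this.\<close>
  have "conc (ref_words \<alpha>) X \<subseteq> X"
    using Star.prems(3) by simp
  moreover from this have "conc (entry_loops \<alpha>) X \<subseteq> X"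
    using conc_mono[OF entry_loops_subset] by blast
  ultimately obtain L1 where L1: "residual D i \<alpha> X X L1"
    using Star.IH[of i X X] Star.prems(1) by auto
  define L where "L = L1(?k + 1 := K)"
  have "residual D i \<alpha> X X L"
    by (rule residual_cong[OF L1]) (use Star.prems(1) L1 in \<open>auto simp: L_def residual_def\<close>)
  moreover have "L D = UNIV" "L i = X" "L (?k + 1) = K"
    using Star.prems(1) L1 by (auto simp: L_def residual_def)
  \<comment> \<open>The edge that skips the body corresponds to zero iterations.\<close>
  moreover have "K \<subseteq> X"
  proof
    fix u assume "u \<in> K"
    moreover have "[] \<in> ref_words (Star \<alpha>)"
      by (simp add: exI[of _ "[]"])
    ultimately have "[] @ u \<in> conc (ref_words (Star \<alpha>)) K"
      unfolding conc_def by blast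
    then show "u \<in> X" using Star.prems(2) by auto
  qed
  ultimately have "residual D i (Star \<alpha>) X K L"
    by (simp add: residual_def closed_under_simps Let_def numeral_3_eq_3 add_ac)
  then show ?case by (rule exI[of _ L])
next
  case (Bind x \<alpha>)
  let ?k = "i + 2 + regex_size \<alpha>"
  have sub: "conc (entry_loops \<gamma>) (conc (ref_words \<gamma>) K) \<subseteq> conc (ref_words \<gamma>) K" for \<gamma> K
    using entry_loops_conc[of \<gamma>] by (simp add: conc_assoc[symmetric] conc_mono)
  define K1 where "K1 = conc {[Close x]} K"
  define X1 where "X1 = conc (ref_words \<alpha>) K1"
  obtain L1 where L1: "residual D (i + 2) \<alpha> X1 K1 L1"
    using Bind.IH[of "i + 2" K1 X1] Bind.prems(1) sub by (auto simp: X1_def)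
  define L where "L p = (if p = D then UNIV else if p = i then X else if p = i + 1 then X1
    else if p \<le> ?k then L1 p else K)" for p
  have "residual D (i + 2) \<alpha> X1 K1 L"
    by (rule residual_cong[OF L1]) (use Bind.prems(1) in \<open>auto simp: L_def\<close>)
  moreover have "L D = UNIV" "L i = X" "L (i + 1) = X1" "L (?k + 1) = K"
    using Bind.prems(1) L1 by (auto simp: L_def residual_def)
  moreover have "ref_words (Bind x \<alpha>) = conc {[Open x]} (conc (ref_words \<alpha>) {[Close x]})"
    by (auto simp: conc_def)
  then have "conc {[Open x]} X1 \<subseteq> X"
    using Bind.prems(2) by (simp add: X1_def K1_def conc_assoc)
  ultimately have "residual D i (Bind x \<alpha>) X K L"
    by (simp add: residual_def closed_under_simps Let_def numeral_3_eq_3 add_ac)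
       (simp add: K1_def label_words_def)
  then show ?case by (rule exI[of _ L])
qed

section \<open>The automaton of a whole formula\<close>

definition automaton :: "('a, 'v) regex \<Rightarrow> (nat, 'a, 'v) vsa" where
  "automaton \<alpha> = \<lparr>avars = vars \<alpha>, states = {..<regex_size \<alpha> + 2}, init = 0, final = regex_size \<alpha>,
     delta = \<lambda>p l. {q. (p, l, q) \<in> set (edges (regex_size \<alpha> + 1) 0 \<alpha>)}\<rparr>"

lemma vset_automaton_automaton: "vset_automaton (automaton \<alpha>)"
proof -
  have "p < regex_size \<alpha> + 2 \<and> q < regex_size \<alpha> + 2 \<and>
      l \<in> {None} \<union> Some ` (range Letter \<union> Gamma (vars \<alpha>))"
    if "(p, l, q) \<in> set (edges (regex_size \<alpha> + 1) 0 \<alpha>)" for p l q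
    using edges_bounds[OF that] edges_label[of p _ q "regex_size \<alpha> + 1" 0 \<alpha>] that
    by (cases l) auto
  then show ?thesis
    unfolding vset_automaton_def automaton_def by (auto simp: finite_vars)
qed

lemma accepted_automaton: "accepted (automaton \<alpha>) = ref_words \<alpha>"
proof
  \<comment> \<open>Nothing follows the whole formula, so the continuation is
    \<open>{[]}\<close>.\<close>
  obtain L where "residual (regex_size \<alpha> + 1) 0 \<alpha> (ref_words \<alpha>) {[]} L"
    using residual_ex[of 0 \<alpha> "regex_size \<alpha> + 1" "{[]}" "ref_words \<alpha>"] entry_loops_conc[of \<alpha>]
    by (auto simp: conc_def)
  then have L: "closed_under (set (edges (regex_size \<alpha> + 1) 0 \<alpha>)) L" "L 0 = ref_words \<alpha>"
      "L (regex_size \<alpha>) = {[]}"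
    by (auto simp: residual_def)
  show "accepted (automaton \<alpha>) \<subseteq> ref_words \<alpha>"
  proof
    fix u assume "u \<in> accepted (automaton \<alpha>)"
    then have "run (automaton \<alpha>) 0 u (regex_size \<alpha>)"
      by (simp add: accepted_def automaton_def)
    then have "u \<in> L 0"
      by (rule run_residual[OF L(1), rotated]) (simp_all add: L automaton_def)
    then show "u \<in> ref_words \<alpha>" by (simp add: L)
  qed
  show "ref_words \<alpha> \<subseteq> accepted (automaton \<alpha>)"
    using edges_complete[of "regex_size \<alpha> + 1" 0 \<alpha> "automaton \<alpha>"]
    by (auto simp: accepted_def automaton_def)
qed

section \<open>The RAM program\<close>

text \<open>
  With \<open>n\<close> the length of the input, the memory holds the input from address \<open>0\<close>, the stack from \<open>n\<close>
  upwards, the variables from \<open>3 n + 3\<close> downwards, the number \<open>2 n\<close> of edges at \<open>3 n + 4\<close>, and the edges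
  from \<open>3 n + 5\<close> upwards. Thus the variables, whose number is unknown in advance, end up contiguous
  with the edges, and the header of the output is put in front of them at the end.

  Registers: 0 is \<open>n\<close>, 2 the position \<open>i\<close>, 3 the next free address of the stack, 4 the initial
  state of the last completed subformula, 5 and 6 the next free address for variables and for edges,
  7 is 1, 8 is \<open>3 n + 3\<close>, 9 is \<open>9 + C\<close> (the code of the first variable), 10 is the state \<open>n + 1\<close>,
  11 the current symbol; 12 to 15 hold the first edge of the symbol, 16 and 17 the ends of its
  second edge, which is always labelled \<open>\<epsilon>\<close>; 18 is 0 and 19 is scratch. The stack holds the positions
  of open parentheses and of pending variable symbols, each parenthesis followed by the position
  of its \<open>\<or>\<close>, or by \<open>n + 1\<close> for \<open>\<cdot>\<close>. The variable of a closing brace is read off the input again.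
\<close>

definition prog :: "nat \<Rightarrow> instr list" where
  "prog C =
   [Const 7 1, Const 9 (9 + C), Add 10 0 7, Add 3 0 18, Const 19 3, Mul 6 0 19, Const 19 5,
    Add 6 6 19, Sub 5 6 7, Add 19 0 0, Store 5 19, Sub 5 5 7, Add 8 5 18,
    \<comment> \<open>13: loop head\<close>
    JumpLess 2 0 15, Jump 93, Load 11 2, Add 12 2 18, Const 13 0, Const 14 0, Add 15 2 7,
    Add 16 10 18, Add 17 2 7, Const 19 0,
    \<comment> \<open>23: dispatch\<close>
    Add 19 19 7, JumpLess 11 19 52,
    Add 19 19 7, JumpLess 11 19 53,
    Add 19 19 7, JumpLess 11 19 46,
    Add 19 19 7, JumpLess 11 19 62,
    Add 19 19 7, JumpLess 11 19 55,
    Add 19 19 7, JumpLess 11 19 59,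
    Add 19 19 7, JumpLess 11 19 67,
    Add 19 19 7, JumpLess 11 19 75,
    Add 19 19 7, JumpLess 11 19 70,
    JumpLess 11 9 49,
    \<comment> \<open>42: variable; 46: left parenthesis\<close>
    Sub 14 11 9, Const 13 2, Store 5 14, Sub 5 5 7,
    Store 3 2, Add 3 3 7, Jump 75,
    \<comment> \<open>49: letter; 52: \<open>\<emptyset>\<close>; 53: \<open>\<epsilon>\<close>\<close>
    Sub 14 11 19, Const 13 1, Jump 53,
    Add 12 10 18,
    Add 4 2 18, Jump 75,
    \<comment> \<open>55: \<open>\<or>\<close>; 59: \<open>\<cdot>\<close>\<close>
    Add 12 10 18, Sub 19 3 7, Load 16 19, Jump 46,
    Store 3 10, Add 3 3 7, Jump 75,
    \<comment> \<open>62: right parenthesis; 67: star; 70: right brace\<close>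
    Sub 3 3 7, Load 16 3, Sub 3 3 7, Load 4 3, Jump 75,
    Add 15 4 18, Add 16 4 18, Jump 75,
    Sub 3 3 7, Load 4 3, Load 14 4, Sub 14 14 9, Const 13 3,
    \<comment> \<open>75: write two edges\<close>
    Store 6 12, Add 6 6 7, Store 6 13, Add 6 6 7, Store 6 14, Add 6 6 7, Store 6 15, Add 6 6 7,
    Store 6 16, Add 6 6 7, Store 6 18, Add 6 6 7, Store 6 18, Add 6 6 7, Store 6 17, Add 6 6 7,
    Add 2 2 7, Jump 13,
    \<comment> \<open>93: write the header\<close>
    Sub 19 8 5, Store 5 19, Sub 5 5 7, Store 5 0, Sub 5 5 7, Store 5 18, Sub 5 5 7,
    Add 19 10 7, Store 5 19, Sub 1 6 5, Add 0 5 18]"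

section \<open>Symbolic execution\<close>

lemma length_prog: "length (prog C) = 104"
  by (simp add: prog_def)

lemma step_prog:
  "i < 104 \<Longrightarrow> step w (prog C) (Config i R M) = exec w (prog C ! i) (Config i R M)"
  by (simp add: step_def halted_def length_prog)

text \<open>Unfolding happens only under a numeral index, which keeps \<open>prog C\<close> folded
  elsewhere; indices 0 and 1 are not of this form.\<close>

lemmas prog_nth = arg_cong[OF prog_def, where f = "\<lambda>P. P ! numeral k" for k]

lemma prog_nth_0_1: "prog C ! 0 = Const 7 1" "prog C ! 1 = Const 9 (9 + C)"
  by (simp_all add: prog_def)

text \<open>Peeling off the first step, not the last, always leaves a concrete configuration to
  rewrite.\<close>

lemma funpow_numeral_unfold: "(f ^^ numeral k) x = (f ^^ pred_numeral k) (f x)"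
  by (simp add: numeral_eq_Suc funpow_swap1)

lemma funpow_one_apply: "((f :: 'b \<Rightarrow> 'b) ^^ 1) x = f x"
  by simp

lemma plus_one_simps:
  "a + 1 + 1 = a + (2::nat)"
  "a + numeral k + 1 = a + (numeral (Num.inc k) :: nat)"
  by (simp_all add: numeral_inc)

lemmas exec_simps = step_prog prog_nth funpow_numeral_unfold funpow_one_apply plus_one_simps


text \<open>Program counters and addresses have to stay numerals.\<close>

declare One_nat_def [simp del] add_2_eq_Suc [simp del] add_2_eq_Suc' [simp del]

section \<open>Memory contents, loop invariants and timed triples\<close>

definition seg :: "(nat \<Rightarrow> nat) \<Rightarrow> nat \<Rightarrow> nat list \<Rightarrow> bool" where
  "seg M a ys \<longleftrightarrow> (\<forall>j<length ys. M (a + j) = ys ! j)"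

lemma seg_Nil [simp]: "seg M a []"
  by (simp add: seg_def)

lemma seg_Cons [simp]: "seg M a (y # ys) \<longleftrightarrow> M a = y \<and> seg M (a + 1) ys"
  unfolding seg_def length_Cons All_less_Suc2 by (simp add: One_nat_def)

lemma seg_append [simp]: "seg M a (ys @ zs) \<longleftrightarrow> seg M a ys \<and> seg M (a + length ys) zs"
  by (induction ys arbitrary: a) (simp_all add: One_nat_def)

lemma seg_update [simp]:
  assumes "p < a \<or> a + length ys \<le> p"
  shows "seg (M(p := v)) a ys \<longleftrightarrow> seg M a ys"
proof -
  have "a + j \<noteq> p" if "j < length ys" for j
    using assms that by linarith
  then show ?thesis by (simp add: seg_def)
qed

lemma map_seg: "seg M a ys \<Longrightarrow> map M [a..<a + length ys] = ys"
  by (rule nth_equalityI) (simp_all add: seg_def)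

text \<open>\<open>\<sigma>\<close> has the top of the stack first while the stack grows upwards,
  hence \<open>rev\<close>. Two edges of four words per symbol give \<open>8 * i\<close>.\<close>

definition layout ::
  "nat \<Rightarrow> nat list \<Rightarrow> nat \<Rightarrow> nat list \<Rightarrow> nat \<Rightarrow> nat list \<Rightarrow> nat list \<Rightarrow> (nat \<Rightarrow> nat) \<Rightarrow> (nat \<Rightarrow> nat) \<Rightarrow> bool" where
  "layout C xs i \<sigma> s vs ts R M \<longleftrightarrow>
     R 0 = length xs \<and> R 2 = i \<and> R 3 = length xs + length \<sigma> \<and> R 4 = s \<and>
     R 5 + length vs = 3 * length xs + 3 \<and> R 6 = 3 * length xs + 5 + length ts \<and> R 7 = 1 \<and>
     R 8 = 3 * length xs + 3 \<and> R 9 = 9 + C \<and> R 10 = length xs + 1 \<and> R 18 = 0 \<and>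
     seg M 0 xs \<and> seg M (length xs) (rev \<sigma>) \<and> seg M (R 5 + 1) vs \<and>
     M (3 * length xs + 4) = 2 * length xs \<and> seg M (3 * length xs + 5) ts \<and>
     length ts = 8 * i \<and> i \<le> length xs \<and> s \<le> length xs"

text \<open>The length bounds keep the stack below address \<open>2 * length xs\<close> and the
  variables above \<open>2 * length xs + 3\<close>, so the two never meet.\<close>

definition ready ::
  "nat \<Rightarrow> nat list \<Rightarrow> nat \<Rightarrow> nat list \<Rightarrow> nat \<Rightarrow> nat list \<Rightarrow> nat list \<Rightarrow> config \<Rightarrow> bool" where
  "ready C xs i \<sigma> s vs ts c \<longleftrightarrow> (\<exists>R M. c = Config 13 R M \<and> layout C xs i \<sigma> s vs ts R M \<and>
     length \<sigma> \<le> i \<and> length vs \<le> i)"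

definition emitting ::
  "nat \<Rightarrow> nat list \<Rightarrow> nat \<Rightarrow> nat list \<Rightarrow> nat \<Rightarrow> nat list \<Rightarrow> nat list \<Rightarrow> nat list \<Rightarrow> config \<Rightarrow> bool" where
  "emitting C xs i \<sigma> s vs ts es c \<longleftrightarrow> (\<exists>R M. c = Config 75 R M \<and> layout C xs i \<sigma> s vs ts R M \<and>
     length \<sigma> \<le> i + 1 \<and> length vs \<le> i + 1 \<and> i < length xs \<and>
     es = [R 12, R 13, R 14, R 15, R 16, 0, 0, R 17])"

text \<open>A total-correctness triple with a bound on the number of steps.\<close>

definition leads :: "nat \<Rightarrow> nat \<Rightarrow> nat \<Rightarrow> (config \<Rightarrow> bool) \<Rightarrow> (config \<Rightarrow> bool) \<Rightarrow> bool" where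
  "leads w C T P Q \<longleftrightarrow> (\<forall>c. P c \<longrightarrow> (\<exists>t\<le>T. Q ((step w (prog C) ^^ t) c)))"

lemma leadsI: "(\<And>c. P c \<Longrightarrow> Q ((step w (prog C) ^^ T) c)) \<Longrightarrow> leads w C T P Q"
  unfolding leads_def by blast

lemma leads_trans:
  assumes "leads w C T P Q" "leads w C T' Q R"
  shows "leads w C (T + T') P R"
  unfolding leads_def
proof (intro allI impI)
  fix c assume "P c"
  then obtain t where t: "t \<le> T" "Q ((step w (prog C) ^^ t) c)"
    using assms(1) unfolding leads_def by blast
  then obtain t' where "t' \<le> T'" "R ((step w (prog C) ^^ t') ((step w (prog C) ^^ t) c))"
    using assms(2) unfolding leads_def by blast
  then show "\<exists>t\<le>T + T'. R ((step w (prog C) ^^ t) c)"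
    using t by (intro exI[of _ "t' + t"]) (simp add: funpow_add)
qed

lemma leads_weaken: "leads w C T P Q \<Longrightarrow> T \<le> T' \<Longrightarrow> Q = Q' \<Longrightarrow> leads w C T' P Q'"
  unfolding leads_def by (meson le_trans)

section \<open>Effect and cost of one symbol\<close>

context
  fixes w C :: nat and xs :: "nat list"
  assumes bound: "150 * length xs + C < 2 ^ w" and nonempty: "0 < length xs"
begin

lemma emit_edges:
  "leads w C 18 (emitting C xs i \<sigma> s vs ts es) (ready C xs (i + 1) \<sigma> s vs (ts @ es))"
proof (rule leadsI)
  fix c assume "emitting C xs i \<sigma> s vs ts es c"
  then obtain R M where c: "c = Config 75 R M" and inv: "layout C xs i \<sigma> s vs ts R M"
    and b: "length \<sigma> \<le> i + 1" "length vs \<le> i + 1" "i < length xs"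
    and es: "es = [R 12, R 13, R 14, R 15, R 16, 0, 0, R 17]"
    unfolding emitting_def by blast
  \<comment> \<open>The edges end at or before address \<open>11 * length xs + 5\<close>, so no
    address wraps around.\<close>
  have "R 6 + 8 < 2 ^ w" "R 2 + 1 < 2 ^ w" "R 7 = 1"
    using inv b bound by (auto simp: layout_def)
  then have "(step w (prog C) ^^ 18) c = Config 13 (R(6 := R 6 + 8, 2 := R 2 + 1))
    (M(R 6 := R 12, R 6 + 1 := R 13, R 6 + 2 := R 14, R 6 + 3 := R 15, R 6 + 4 := R 16,
       R 6 + 5 := R 18, R 6 + 6 := R 18, R 6 + 7 := R 17))"
    by (simp add: c exec_simps)
  then show "ready C xs (i + 1) \<sigma> s vs (ts @ es) ((step w (prog C) ^^ 18) c)"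
    using inv b by (simp add: ready_def layout_def es plus_one_simps)
qed

lemma input_nth: "seg M 0 xs \<Longrightarrow> i < length xs \<Longrightarrow> M i = xs ! i"
  by (simp add: seg_def)

lemma w_pos: "0 < w"
  using bound nonempty by (cases w) auto

lemma word_size: "150 < (2 :: nat) ^ w" "9 + C < 2 ^ w"
  using bound nonempty by linarith+

lemmas fetch_simps = ready_def emitting_def layout_def exec_simps input_nth w_pos

text \<open>The step counts here and below are exact path lengths; dispatch compares the code with
  1, ..., 9 in turn, at two steps each.\<close>

lemma fetch_Empty:
  assumes "i < length xs" "xs ! i = 0"
  shows "leads w C 14 (ready C xs i \<sigma> s vs ts)
    (emitting C xs i \<sigma> i vs ts [length xs + 1, 0, 0, i + 1, length xs + 1, 0, 0, i + 1])"
  using assms bound by (intro leadsI) (auto simp: fetch_simps)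

lemma fetch_Epsilon:
  assumes "i < length xs" "xs ! i = 1"
  shows "leads w C 15 (ready C xs i \<sigma> s vs ts)
    (emitting C xs i \<sigma> i vs ts [i, 0, 0, i + 1, length xs + 1, 0, 0, i + 1])"
  using assms bound by (intro leadsI) (auto simp: fetch_simps)

lemma fetch_LParen:
  assumes "i < length xs" "xs ! i = 2"
  shows "leads w C 18 (ready C xs i \<sigma> s vs ts)
    (emitting C xs i (i # \<sigma>) s vs ts [i, 0, 0, i + 1, length xs + 1, 0, 0, i + 1])"
  using assms bound by (intro leadsI) (auto simp: fetch_simps)

text \<open>For a disjunction \<open>k\<close> is the final state of the left operand; for a
  concatenation it is the padding state, so the second edge is inert.\<close>

lemma fetch_RParen:
  assumes "i < length xs" "xs ! i = 3" "a \<le> length xs"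
  shows "leads w C 22 (ready C xs i (k # a # \<sigma>) s vs ts)
    (emitting C xs i \<sigma> a vs ts [i, 0, 0, i + 1, k, 0, 0, i + 1])"
  using assms bound by (intro leadsI) (auto simp: fetch_simps, simp add: One_nat_def)

text \<open>The position of the parenthesis is read without popping, because the closing parenthesis
  uses it again.\<close>

lemma fetch_Or:
  assumes "i < length xs" "xs ! i = 4"
  shows "leads w C 26 (ready C xs i (a # \<sigma>) s vs ts)
    (emitting C xs i (i # a # \<sigma>) s vs ts [length xs + 1, 0, 0, i + 1, a, 0, 0, i + 1])"
  using assms bound by (intro leadsI) (auto simp: fetch_simps)

lemma fetch_Cat:
  assumes "i < length xs" "xs ! i = 5"
  shows "leads w C 24 (ready C xs i \<sigma> s vs ts)
    (emitting C xs i ((length xs + 1) # \<sigma>) s vs ts [i, 0, 0, i + 1, length xs + 1, 0, 0, i + 1])"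
  using assms bound by (intro leadsI) (auto simp: fetch_simps)

lemma fetch_Star:
  assumes "i < length xs" "xs ! i = 6"
  shows "leads w C 26 (ready C xs i \<sigma> s vs ts)
    (emitting C xs i \<sigma> s vs ts [i, 0, 0, s, s, 0, 0, i + 1])"
  using assms bound by (intro leadsI) (auto simp: fetch_simps)

lemma fetch_LBrace:
  assumes "i < length xs" "xs ! i = 7"
  shows "leads w C 25 (ready C xs i \<sigma> s vs ts)
    (emitting C xs i \<sigma> s vs ts [i, 0, 0, i + 1, length xs + 1, 0, 0, i + 1])"
  using assms bound by (intro leadsI) (auto simp: fetch_simps)

text \<open>The popped position serves twice: as initial state of the binding and as input address
  of its variable.\<close>

lemma fetch_RBrace:
  assumes "i < length xs" "xs ! i = 8" "a < length xs"
  shows "leads w C 32 (ready C xs i (a # \<sigma>) s vs ts)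
    (emitting C xs i \<sigma> a vs ts [i, 3, xs ! a - (9 + C), i + 1, length xs + 1, 0, 0, i + 1])"
  using assms bound by (intro leadsI) (auto simp: fetch_simps)

lemma fetch_Sym:
  assumes "i < length xs" "xs ! i = 9 + b" "b < C"
  shows "leads w C 33 (ready C xs i \<sigma> s vs ts)
    (emitting C xs i \<sigma> i vs ts [i, 1, b, i + 1, length xs + 1, 0, 0, i + 1])"
  using assms bound by (intro leadsI) (auto simp: fetch_simps)

lemma fetch_Var:
  assumes "i < length xs" "xs ! i = 9 + C + y"
  shows "leads w C 35 (ready C xs i \<sigma> s vs ts)
    (emitting C xs i (i # \<sigma>) s (y # vs) ts [i, 2, y, i + 1, length xs + 1, 0, 0, i + 1])"
  using assms bound by (intro leadsI) (auto simp: fetch_simps, simp add: One_nat_def)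

lemma prologue:
  "ready C xs 0 [] 0 [] [] ((step w (prog C) ^^ 13) (initial xs))"
  using bound word_size w_pos
  by (simp add: initial_def exec_simps prog_nth_0_1 ready_def layout_def) (simp add: seg_def)

lemma epilogue:
  assumes "ready C xs (length xs) \<sigma> s vs ts c"
  shows "halted (prog C) ((step w (prog C) ^^ 13) c)"
    and "ram_output ((step w (prog C) ^^ 13) c) =
      [length xs + 2, 0, length xs] @ [length vs] @ vs @ [2 * length xs] @ ts"
proof -
  let ?ys = "[length xs + 2, 0, length xs] @ [length vs] @ vs @ [2 * length xs] @ ts"
  obtain R M where c: "c = Config 13 R M" and inv: "layout C xs (length xs) \<sigma> s vs ts R M"
    and len: "length vs \<le> length xs"
    using assms unfolding ready_def by blast
  \<comment> \<open>The header takes four words and ends at \<open>R 5\<close>. The subtraction does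
    not truncate, since at most \<open>length xs\<close> variables were written.\<close>
  define v where "v = R 5 - 3"
  have v: "v + length vs = 3 * length xs" "R 5 = v + 3"
    using inv len by (auto simp: layout_def v_def)
  then have R: "R 0 = length xs" "R 2 = length xs" "R 5 = v + 3" "R 6 = v + length vs + 5 + length ts"
      "R 7 = 1" "R 8 = v + length vs + 3" "R 10 = length xs + 1" "R 18 = 0"
      "M (v + length vs + 4) = 2 * length xs" "seg M (v + length vs + 5) ts"
      "length ts = 8 * length xs"
    using inv by (auto simp: layout_def)
  have "seg M (R 5 + 1) vs" "R 5 + 1 = v + 4"
    using inv v by (simp_all add: layout_def)
  then have vs: "seg M (v + 4) vs"
    by simp
  have small: "v + 5 < 2 ^ w" "length xs + 2 < 2 ^ w" "v < 2 ^ w"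
    using v bound word_size by linarith+
  define M' where "M' = M(v + 3 := length vs, v + 3 - 1 := length xs, v + 3 - 1 - 1 := 0, v := length xs + 2)"
  have fin: "\<exists>R'. (step w (prog C) ^^ 13) c = Config 104 R' M' \<and> R' 0 = v \<and> R' 1 = length ?ys"
    using R small w_pos by (simp add: c exec_simps M'_def)
  then obtain R' where R': "(step w (prog C) ^^ 13) c = Config 104 R' M'" "R' 0 = v" "R' 1 = length ?ys"
    by blast
  have "seg M' v ?ys"
    using R vs by (simp add: M'_def numeral_eq_Suc One_nat_def)
  then have "map M' [v..<v + length ?ys] = ?ys"
    by (rule map_seg)
  then show "ram_output ((step w (prog C) ^^ 13) c) = ?ys"
    by (simp only: R' ram_output_def config.sel)
  show "halted (prog C) ((step w (prog C) ^^ 13) c)"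
    by (simp add: R' halted_def length_prog)
qed

end

section \<open>Correctness of the translation\<close>

text \<open>The machine records a variable at each binding occurrence, repetitions included, which
  is harmless because \<open>vsa_code\<close> enumerates sets.\<close>

fun binders :: "('a, 'v) regex \<Rightarrow> 'v list" where
  "binders (Or \<alpha> \<beta>) = binders \<alpha> @ binders \<beta>"
| "binders (Cat \<alpha> \<beta>) = binders \<alpha> @ binders \<beta>"
| "binders (Star \<alpha>) = binders \<alpha>"
| "binders (Bind x \<alpha>) = x # binders \<alpha>"
| "binders _ = []"

lemma set_binders: "set (binders \<alpha>) = vars \<alpha>"
  by (induction \<alpha>) simp_all

definition edges_code :: "('a \<Rightarrow> nat) \<Rightarrow> ('v \<Rightarrow> nat) \<Rightarrow> ('a, 'v) edge list \<Rightarrow> nat list" where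
  "edges_code sc vc ts = concat (map (\<lambda>(p, l, q). [p] @ label_code sc vc l @ [q]) ts)"

lemma edges_code_simps [simp]:
  "edges_code sc vc [] = []"
  "edges_code sc vc ((p, l, q) # ts) = p # label_code sc vc l @ q # edges_code sc vc ts"
  "edges_code sc vc (ts @ ts') = edges_code sc vc ts @ edges_code sc vc ts'"
  by (simp_all add: edges_code_def)

lemma length_regex_code [simp]: "length (regex_code sc vc \<alpha>) = regex_size \<alpha>"
  by (simp add: regex_code_def regex_size_def)

lemma regex_code_simps [simp]:
  fixes sc :: "'a::finite \<Rightarrow> nat"
  shows
  "regex_code sc vc Empty = [0]"
  "regex_code sc vc Epsilon = [1]"
  "regex_code sc vc (Sym a) = [9 + sc a]"
  "regex_code sc vc (Or \<alpha> \<beta>) = 2 # regex_code sc vc \<alpha> @ 4 # regex_code sc vc \<beta> @ [3]"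
  "regex_code sc vc (Cat \<alpha> \<beta>) = 2 # regex_code sc vc \<alpha> @ 5 # regex_code sc vc \<beta> @ [3]"
  "regex_code sc vc (Star \<alpha>) = regex_code sc vc \<alpha> @ [6]"
  "regex_code sc vc (Bind x \<alpha>) = (9 + CARD('a) + vc x) # 7 # regex_code sc vc \<alpha> @ [8]"
  by (simp_all add: regex_code_def)

context
  fixes w :: nat and xs :: "nat list" and sc :: "'a::finite \<Rightarrow> nat" and vc :: "'v \<Rightarrow> nat"
  assumes bound: "150 * length xs + CARD('a) < 2 ^ w" and nonempty: "0 < length xs"
    and sc: "\<And>a. sc a < CARD('a)"
begin

lemmas read_Empty = leads_trans[OF fetch_Empty[OF bound nonempty] emit_edges[OF bound nonempty]]
lemmas read_Epsilon = leads_trans[OF fetch_Epsilon[OF bound nonempty] emit_edges[OF bound nonempty]]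
lemmas read_Sym = leads_trans[OF fetch_Sym[OF bound nonempty] emit_edges[OF bound nonempty]]
lemmas read_LParen = leads_trans[OF fetch_LParen[OF bound nonempty] emit_edges[OF bound nonempty]]
lemmas read_Or = leads_trans[OF fetch_Or[OF bound nonempty] emit_edges[OF bound nonempty]]
lemmas read_Cat = leads_trans[OF fetch_Cat[OF bound nonempty] emit_edges[OF bound nonempty]]
lemmas read_RParen = leads_trans[OF fetch_RParen[OF bound nonempty] emit_edges[OF bound nonempty]]
lemmas read_Star = leads_trans[OF fetch_Star[OF bound nonempty] emit_edges[OF bound nonempty]]
lemmas read_Var = leads_trans[OF fetch_Var[OF bound nonempty] emit_edges[OF bound nonempty]]
lemmas read_LBrace = leads_trans[OF fetch_LBrace[OF bound nonempty] emit_edges[OF bound nonempty]]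
lemmas read_RBrace = leads_trans[OF fetch_RBrace[OF bound nonempty] emit_edges[OF bound nonempty]]

text \<open>Stack and earlier output are arbitrary so that the induction hypotheses can be chained.
  A formula restores the stack and leaves its initial state \<open>i\<close> for a following star.
  The factor is 53 = 35 + 18, the cost of a variable symbol, the most expensive one.\<close>

lemma compile:
  fixes \<alpha> :: "('a, 'v) regex"
  assumes "seg ((!) xs) i (regex_code sc vc \<alpha>)" and "i + regex_size \<alpha> \<le> length xs"
  shows "leads w CARD('a) (53 * regex_size \<alpha>) (ready CARD('a) xs i \<sigma> s vs ts)
    (ready CARD('a) xs (i + regex_size \<alpha>) \<sigma> i (rev (map vc (binders \<alpha>)) @ vs)
       (ts @ edges_code sc vc (edges (length xs + 1) i \<alpha>)))"
  using assms
proof (induction \<alpha> arbitrary: i \<sigma> s vs ts)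
  case Empty
  then show ?case
    by (intro leads_weaken[OF read_Empty]) (simp_all add: numeral_eq_Suc)
next
  case Epsilon
  then show ?case
    by (intro leads_weaken[OF read_Epsilon]) simp_all
next
  case (Sym a)
  then show ?case
    by (intro leads_weaken[OF read_Sym[of _ "sc a"]]) (simp_all add: sc)
next
  case (Or \<alpha> \<beta>)
  define k where "k = i + 1 + regex_size \<alpha>"
  define l where "l = k + 1 + regex_size \<beta>"
  have xs: "xs ! i = 2" "seg ((!) xs) (i + 1) (regex_code sc vc \<alpha>)" "xs ! k = 4"
      "seg ((!) xs) (k + 1) (regex_code sc vc \<beta>)" "xs ! l = 3"
    and lt: "i < length xs" "i + 1 + regex_size \<alpha> \<le> length xs" "k < length xs"
      "k + 1 + regex_size \<beta> \<le> length xs" "l < length xs" "i \<le> length xs"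
    using Or.prems by (simp_all add: k_def l_def)
  have l: "i + regex_size (Or \<alpha> \<beta>) = l + 1"
    by (simp add: k_def l_def)
  show ?case
    by (rule leads_weaken[OF leads_trans[OF leads_trans[OF leads_trans[OF leads_trans[OF
          read_LParen[OF lt(1) xs(1)] Or.IH(1)[OF xs(2) lt(2), folded k_def]]
          read_Or[OF lt(3) xs(3)]] Or.IH(2)[OF xs(4) lt(4), folded l_def]]
          read_RParen[OF lt(5) xs(5) lt(6)]]])
       (simp, simp add: l Let_def k_def[symmetric] l_def[symmetric] del: regex_size_simps)
next
  case (Cat \<alpha> \<beta>)
  define k where "k = i + 1 + regex_size \<alpha>"
  define l where "l = k + 1 + regex_size \<beta>"
  have xs: "xs ! i = 2" "seg ((!) xs) (i + 1) (regex_code sc vc \<alpha>)" "xs ! k = 5"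
      "seg ((!) xs) (k + 1) (regex_code sc vc \<beta>)" "xs ! l = 3"
    and lt: "i < length xs" "i + 1 + regex_size \<alpha> \<le> length xs" "k < length xs"
      "k + 1 + regex_size \<beta> \<le> length xs" "l < length xs" "i \<le> length xs"
    using Cat.prems by (simp_all add: k_def l_def)
  have l: "i + regex_size (Cat \<alpha> \<beta>) = l + 1"
    by (simp add: k_def l_def)
  show ?case
    by (rule leads_weaken[OF leads_trans[OF leads_trans[OF leads_trans[OF leads_trans[OF
          read_LParen[OF lt(1) xs(1)] Cat.IH(1)[OF xs(2) lt(2), folded k_def]]
          read_Cat[OF lt(3) xs(3)]] Cat.IH(2)[OF xs(4) lt(4), folded l_def]]
          read_RParen[OF lt(5) xs(5) lt(6)]]])
       (simp, simp add: l Let_def k_def[symmetric] l_def[symmetric] del: regex_size_simps)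
next
  case (Star \<alpha>)
  define k where "k = i + regex_size \<alpha>"
  have xs: "seg ((!) xs) i (regex_code sc vc \<alpha>)" "xs ! k = 6"
    and lt: "i + regex_size \<alpha> \<le> length xs" "k < length xs"
    using Star.prems by (simp_all add: k_def)
  have k: "i + regex_size (Star \<alpha>) = k + 1"
    by (simp add: k_def)
  show ?case
    by (rule leads_weaken[OF leads_trans[OF Star.IH[OF xs(1) lt(1), folded k_def]
          read_Star[OF lt(2) xs(2)]]])
       (simp, simp add: k Let_def k_def[symmetric] del: regex_size_simps)
next
  case (Bind x \<alpha>)
  define k where "k = i + 1 + 1 + regex_size \<alpha>"
  have xs: "xs ! i = 9 + CARD('a) + vc x" "xs ! (i + 1) = 7"
      "seg ((!) xs) (i + 1 + 1) (regex_code sc vc \<alpha>)" "xs ! k = 8"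
    and lt: "i < length xs" "i + 1 < length xs" "i + 1 + 1 + regex_size \<alpha> \<le> length xs"
      "k < length xs"
    using Bind.prems by (simp_all add: k_def)
  have k: "i + regex_size (Bind x \<alpha>) = k + 1" "i + 2 + regex_size \<alpha> = k"
    by (simp_all add: k_def)
  show ?case
    by (rule leads_weaken[OF leads_trans[OF leads_trans[OF leads_trans[OF
          read_Var[OF lt(1) xs(1)] read_LBrace[OF lt(2) xs(2)]]
          Bind.IH[OF xs(3) lt(3), folded k_def]] read_RBrace[OF lt(4) xs(4) lt(1)]]])
       (simp, simp add: k Let_def xs(1) plus_one_simps del: regex_size_simps)
qed

end

theorem lemma3p4:
  fixes sc :: "'a::finite \<Rightarrow> nat" and vc :: "'v \<Rightarrow> nat"
  assumes "CARD('a) \<ge> 2"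
    and "infinite (UNIV :: 'v set)"
    and "bij_betw sc UNIV {..<CARD('a)}"
    and "inj vc"
  shows "\<exists>(P :: instr list) (c :: nat). \<forall>(\<alpha> :: ('a, 'v) regex) (w :: nat).
           functional_regex \<alpha> \<longrightarrow>
           c * regex_size \<alpha> < 2 ^ w \<longrightarrow>
           (\<forall>u \<in> set (regex_code sc vc \<alpha>). u < 2 ^ w) \<longrightarrow>
           (\<exists>(A :: (nat, 'a, 'v) vsa) ys.
              computes_within w P (regex_code sc vc \<alpha>) (c * regex_size \<alpha>) ys \<and>
              vsa_code sc vc A ys \<and>
              vset_automaton A \<and> functional_vsa A \<and>
              vsa_spanner A = regex_spanner \<alpha>)"
proof (rule exI[of _ "prog CARD('a)"], rule exI[of _ "150 + CARD('a)"], intro allI impI)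
  fix \<alpha> :: "('a, 'v) regex" and w :: nat
  assume func: "functional_regex \<alpha>" and size: "(150 + CARD('a)) * regex_size \<alpha> < 2 ^ w"
  let ?C = "CARD('a)"
  define xs where "xs = regex_code sc vc \<alpha>"
  have len: "length xs = regex_size \<alpha>"
    by (simp add: xs_def)
  have pos: "0 < length xs"
    using regex_size_pos[of \<alpha>] len by simp
  \<comment> \<open>As the input is nonempty, the part \<open>CARD('a)\<close> of the constant
    yields the additive \<open>CARD('a)\<close> required of the word size.\<close>
  have "1 \<le> length xs"
    using pos by linarith
  from mult_le_mono2[OF this, of ?C] have "?C \<le> ?C * length xs"
    by simp
  then have bound: "150 * length xs + ?C < 2 ^ w"
    using size unfolding len add_mult_distrib by linarith
  have sc: "sc a < ?C" for a
    using assms(3) by (auto simp: bij_betw_def)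
  let ?es = "edges (length xs + 1) 0 \<alpha>"
  let ?ys = "[length xs + 2, 0, length xs] @ [length (binders \<alpha>)] @ rev (map vc (binders \<alpha>)) @
    [2 * length xs] @ edges_code sc vc ?es"
  let ?run = "\<lambda>t. (step w (prog ?C) ^^ t)"
  have "leads w ?C (53 * regex_size \<alpha>) (ready ?C xs 0 [] 0 [] [])
      (ready ?C xs (length xs) [] 0 (rev (map vc (binders \<alpha>))) (edges_code sc vc ?es))"
    using compile[OF bound pos sc, where i = 0 and vc = vc and \<alpha> = \<alpha> and \<sigma> = "[]" and s = 0
      and vs = "[]" and ts = "[]"] by (simp add: len) (simp add: xs_def seg_def)
  then obtain t where t: "t \<le> 53 * regex_size \<alpha>"
    "ready ?C xs (length xs) [] 0 (rev (map vc (binders \<alpha>))) (edges_code sc vc ?es)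
       (?run t (?run 13 (initial xs)))"
    using prologue[OF bound pos] unfolding leads_def by blast
  have "?run 13 (?run t (?run 13 (initial xs))) = ?run (13 + (t + 13)) (initial xs)"
    by (simp only: funpow_add o_apply)
  \<comment> \<open>Prologue and epilogue take 13 steps each, and 53 n + 26 is at most 150 n for n
    at least 1.\<close>
  moreover have "13 + (t + 13) \<le> (150 + ?C) * regex_size \<alpha>"
    using t(1) regex_size_pos[of \<alpha>] by (simp add: algebra_simps)
  ultimately have "computes_within w (prog ?C) xs ((150 + ?C) * regex_size \<alpha>) ?ys"
    using epilogue[OF bound pos t(2)] unfolding computes_within_def by (metis length_map length_rev)
  moreover have "vsa_code sc vc (automaton \<alpha>) ?ys"
    unfolding vsa_code_def
    \<comment> \<open>Variables are written downwards, hence appear in reverse order of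
      occurrence.\<close>
    by (rule exI[of _ "length xs + 2"], rule exI[of _ "rev (binders \<alpha>)"], rule exI[of _ ?es])
       (simp add: automaton_def len set_binders length_edges edges_code_def rev_map)
  moreover have "functional_vsa (automaton \<alpha>)"
    using func accepted_automaton[of \<alpha>]
    by (simp add: functional_vsa_def functional_regex_def) (simp add: automaton_def)
  moreover have "vsa_spanner (automaton \<alpha>) = regex_spanner \<alpha>"
    using accepted_automaton[of \<alpha>]
    by (simp add: vsa_spanner_def regex_spanner_def) (simp add: automaton_def)
  ultimately show "\<exists>(A :: (nat, 'a, 'v) vsa) ys.
      computes_within w (prog ?C) (regex_code sc vc \<alpha>) ((150 + ?C) * regex_size \<alpha>) ys \<and>
      vsa_code sc vc A ys \<and> vset_automaton A \<and> functional_vsa A \<and>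
      vsa_spanner A = regex_spanner \<alpha>"
    using vset_automaton_automaton[of \<alpha>] unfolding xs_def by blast
qed

end
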